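(* Let $X$ be a real Banach space, let $\Phi_n : X \to \mathbb{R}$ ($n \in \mathbb{N}$) and $\Phi : X \to \mathbb{R}$ be functionals. Suppose that: (i) $\Phi$ and $\Phi_n$ are $C^1$-functionals for every $n\in\mathbb{N}$; (ii) if $(x_n)_{n\in\mathbb{N}} \subset X$ is such that $\sup_{n\in\mathbb{N}} |\Phi_n(x_n)| < \infty$ and $\lim_{n\to\infty} \|\partial \Phi_n(x_n)\| = 0$, then $(x_n)$ has a convergent subsequence; (iii) $\Phi_n \to \Phi$ uniformly on $X$; (iv) $\Phi_n(0)=0$ for every $n\in\mathbb{N}$; (v) $r>0$ is such that $\inf_{x\in S(0,r),\, n\in\mathbb{N}} \Phi_n(x) > 0$; (vi) there exists $x_*\in X$ such that $\|x_*\|>r$ and $\sup_{n\in\mathbb{N}}\Phi_n(x_* )<0$. Then there exists a point $\bar{x}\in X$ such that $$\Phi(\bar{x}) \ge \inf_{x\in S(0,r)} \Phi(x) > 0 \quad\text{and}\quad \partial\Phi(\bar{x}) = 0.$$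
   Context: For a $C^1$-functional $\Psi: X\to\mathbb{R}$, $\partial\Psi(x) \in X^*$ denotes its (Fréchet) derivative at $x$, and $\|\partial\Psi(x)\|$ is the norm in the dual space $X^*$. $S(0,r)=\{x\in X : \|x\|=r\}$. Uniform convergence $\Phi_n\to\Phi$ on $X$ means: for all $\varepsilon>0$ there is $N\in\mathbb{N}$ such that $|\Phi(x)-\Phi_n(x)|<\varepsilon$ for all $x\in X$ and $n\ge N$. *)

theory Defs
  imports "HOL-Analysis.Analysis"
begin

text \<open>
  The dual space of \<open>'a\<close> is the type \<open>'a \<Rightarrow>\<^sub>L real\<close>, whose norm is the operator norm.
  The value of \<open>fderiv f x\<close> is meaningful only where \<open>f\<close> is Frechet differentiable at \<open>x\<close>.
\<close>

definition fderiv :: "('a::real_normed_vector \<Rightarrow> real) \<Rightarrow> 'a \<Rightarrow> 'a \<Rightarrow>\<^sub>L real"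
  where "fderiv f x = Blinfun (frechet_derivative f (at x))"

definition C1_functional :: "('a::real_normed_vector \<Rightarrow> real) \<Rightarrow> bool"
  where "C1_functional f \<longleftrightarrow>
    (\<forall>x. f differentiable (at x)) \<and> continuous_on UNIV (fderiv f)"

lemma has_derivative_fderiv:
  assumes "f differentiable (at x)"
  shows "(f has_derivative blinfun_apply (fderiv f x)) (at x)"
proof -
  have d: "(f has_derivative frechet_derivative f (at x)) (at x)"
    using assms by (simp add: frechet_derivative_works)
  then show ?thesis
    unfolding fderiv_def by (simp add: bounded_linear_Blinfun_apply has_derivative_bounded_linear)
qed

lemma fderiv_eqI:
  assumes "(f has_derivative blinfun_apply D) (at x)"
  shows "fderiv f x = D"
  unfolding fderiv_def frechet_derivative_at[OF assms, symmetric] by (rule blinfun_apply_inverse)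

end

theory Submission
  imports Defs
begin

text \<open>
  Uniform convergence says nothing about the derivatives: a limit of critical points of the
  \<open>\<Phi>n n\<close> need not be critical for \<open>\<Phi>\<close>, because a small, rapidly oscillating perturbation creates
  critical points anywhere. The argument therefore looks for almost critical points of the limit
  \<open>\<Phi>\<close> and uses the perturbed functionals only to obtain compactness.

  The limit inherits the mountain pass geometry: \<open>\<Phi> 0 = 0\<close>, \<open>\<Phi>\<close> is at most \<open>0\<close> at the far point,
  and its infimum \<open>m\<close> over the sphere is positive. Ekeland's principle, applied to the maximum of
  \<open>\<Phi>\<close> along a path as a function of the path, then gives points \<open>y k\<close> with \<open>\<Phi> (y k) \<ge> m\<close>, with
  \<open>\<Phi> (y k)\<close> bounded above and with \<open>fderiv \<Phi> (y k)\<close> tending to \<open>0\<close>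
  (\<open>mountain_pass_almost_critical\<close>).

  Almost criticality, unlike criticality, passes from \<open>\<Phi>\<close> to \<open>\<Phi>n n\<close>. If the derivative of \<open>\<Phi>\<close> at
  \<open>y\<close> has norm at most \<open>\<delta>\<close>, then on a small ball of radius \<open>\<rho>\<close> around \<open>y\<close> the values of \<open>\<Phi>\<close> stay
  within \<open>2\<delta>\<rho>\<close> of \<open>\<Phi> y\<close>. For large \<open>n\<close> the values of \<open>\<Phi>n n\<close> do so up to a further error of size
  \<open>\<delta>\<rho>\<close>, and Ekeland's principle on the ball gives a point at which the derivative of \<open>\<Phi>n n\<close> has
  norm at most \<open>8\<delta>\<close> (\<open>uniform_limit_almost_critical\<close>). A diagonal choice
  (\<open>diagonal_eventually\<close>) turns this into a sequence \<open>x\<close> to which the Palais-Smale hypothesis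
  applies, and \<open>x n\<close> gets arbitrarily close to \<open>y (\<kappa> n)\<close> with \<open>\<kappa> n\<close> tending to infinity. Hence a
  limit of a subsequence of \<open>x\<close> is also a limit of points \<open>y (\<kappa> n)\<close>, and there the continuity of
  \<open>\<Phi>\<close> and of its derivative gives the claim.
\<close>

section \<open>Ekeland's variational principle\<close>

text \<open>
  Starting at \<open>x0\<close>, one repeatedly moves to an almost lowest point among those that pay for their
  distance by a decrease of \<open>f\<close> at rate \<open>\<epsilon>\<close>. The total length of the moves is bounded by the total
  decrease, so they converge, and no point of \<open>S\<close> lies far enough below the limit to pay for its
  distance. Lower semicontinuity on \<open>S\<close> is expressed by closed sublevel sets.
\<close>
lemma ekeland_variational_principle:
  fixes f :: "'a::metric_space \<Rightarrow> real"
  assumes S: "complete S" and x0: "x0 \<in> S" and \<epsilon>: "\<epsilon> > 0"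
    and bdd: "\<And>x. x \<in> S \<Longrightarrow> b \<le> f x"
    and lsc: "\<And>a. closed {x \<in> S. f x \<le> a}"
  obtains z where "z \<in> S" "f z + \<epsilon> * dist x0 z \<le> f x0"
    "\<And>y. y \<in> S \<Longrightarrow> f z - \<epsilon> * dist z y \<le> f y"
proof -
  define T where "T x = {y \<in> S. f y + \<epsilon> * dist x y \<le> f x}" for x
  have T_self: "x \<in> T x" if "x \<in> S" for x
    using that by (simp add: T_def)
  have T_trans: "z \<in> T x" if "y \<in> T x" "z \<in> T y" for x y z
  proof -
    have "\<epsilon> * dist x z \<le> \<epsilon> * (dist x y + dist y z)"
      using \<epsilon> by (intro mult_left_mono dist_triangle) auto
    then show ?thesis
      using that by (auto simp: T_def algebra_simps)
  qed
  have step: "\<exists>y. y \<in> T x \<and> (\<forall>w \<in> T x. f y \<le> f w + 1 / (real n + 1))" if "x \<in> S" for x n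
  proof -
    have ne: "f ` T x \<noteq> {}" using T_self[OF that] by auto
    have bb: "bdd_below (f ` T x)"
      by (rule bdd_belowI[of _ b]) (auto simp: T_def bdd)
    have "Inf (f ` T x) < Inf (f ` T x) + 1 / (real n + 1)" by simp
    then obtain y where y: "y \<in> T x" "f y < Inf (f ` T x) + 1 / (real n + 1)"
      unfolding cInf_less_iff[OF ne bb] by blast
    have "f y \<le> f w + 1 / (real n + 1)" if "w \<in> T x" for w
      using y(2) cInf_lower[OF imageI[OF that] bb] by linarith
    with y(1) show ?thesis by blast
  qed
  have "\<exists>x. \<forall>n. (x n \<in> S \<and> (n = 0 \<longrightarrow> x n = x0)) \<and>
      (x (Suc n) \<in> T (x n) \<and> (\<forall>w \<in> T (x n). f (x (Suc n)) \<le> f w + 1 / (real n + 1)))"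
  proof (rule dependent_nat_choice)
    show "\<exists>x. x \<in> S \<and> (0 = (0::nat) \<longrightarrow> x = x0)" using x0 by auto
  next
    fix x n assume "x \<in> S \<and> (n = (0::nat) \<longrightarrow> x = x0)"
    then obtain y where "y \<in> T x" "\<forall>w \<in> T x. f y \<le> f w + 1 / (real n + 1)"
      using step by blast
    then show "\<exists>y. (y \<in> S \<and> (Suc n = 0 \<longrightarrow> y = x0)) \<and>
        (y \<in> T x \<and> (\<forall>w \<in> T x. f y \<le> f w + 1 / (real n + 1)))"
      by (auto simp: T_def)
  qed
  then obtain x where xS: "\<And>n. x n \<in> S" and x_0: "x 0 = x0"
    and xT: "\<And>n. x (Suc n) \<in> T (x n)"
    and xmin: "\<And>n w. w \<in> T (x n) \<Longrightarrow> f (x (Suc n)) \<le> f w + 1 / (real n + 1)"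
    by metis
  have chain: "x m \<in> T (x n)" if "n \<le> m" for m n
    using that by (induction m rule: dec_induct) (auto intro: T_self xS T_trans xT)
  have gap: "\<epsilon> * dist (x n) (x m) \<le> f (x n) - f (x m)" if "n \<le> m" for m n
    using chain[OF that] by (simp add: T_def)
  have dec: "decseq (\<lambda>n. f (x n))"
  proof (rule decseq_SucI)
    fix n show "f (x (Suc n)) \<le> f (x n)"
      using gap[of n "Suc n"] mult_nonneg_nonneg[OF less_imp_le[OF \<epsilon>] zero_le_dist, of "x n" "x (Suc n)"]
      by simp
  qed
  then obtain L where L: "(\<lambda>n. f (x n)) \<longlonglongrightarrow> L" and Lle: "\<And>n. L \<le> f (x n)"
    using decseq_convergent[of "\<lambda>n. f (x n)" b] bdd xS by blast
  have "Cauchy x"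
  proof (rule metric_CauchyI)
    fix e :: real assume e: "e > 0"
    have "\<forall>\<^sub>F n in sequentially. f (x n) < L + \<epsilon> * e / 2"
      using L e \<epsilon> by (intro order_tendstoD) auto
    then obtain N where N: "f (x N) < L + \<epsilon> * e / 2"
      by (auto simp: eventually_sequentially)
    have close: "dist (x N) (x n) < e / 2" if "n \<ge> N" for n
    proof -
      have "\<epsilon> * dist (x N) (x n) < \<epsilon> * (e / 2)"
        using gap[OF that] Lle[of n] N by simp
      then show ?thesis using \<epsilon> by (simp only: mult_less_cancel_left_pos)
    qed
    show "\<exists>M. \<forall>m\<ge>M. \<forall>n\<ge>M. dist (x m) (x n) < e"
      using close dist_triangle_half_r by blast
  qed
  then obtain z where z: "z \<in> S" "x \<longlonglongrightarrow> z"
    using S xS unfolding complete_def by blast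
  have fz: "f z \<le> f (x n)" for n
  proof -
    have "z \<in> {y \<in> S. f y \<le> f (x n)}"
    proof (rule closed_sequentially[OF lsc])
      show "\<And>k. x (k + n) \<in> {y \<in> S. f y \<le> f (x n)}"
        using dec xS by (auto simp: decseq_def)
      show "(\<lambda>k. x (k + n)) \<longlonglongrightarrow> z"
        using z(2) by (rule LIMSEQ_ignore_initial_segment)
    qed
    then show ?thesis by simp
  qed
  have zL: "f z \<le> L"
    using LIMSEQ_le_const[OF L] fz by blast
  have zT: "z \<in> T (x n)" for n
  proof -
    have "\<epsilon> * dist (x n) z \<le> f (x n) - L"
    proof (rule LIMSEQ_le)
      show "(\<lambda>m. \<epsilon> * dist (x n) (x m)) \<longlonglongrightarrow> \<epsilon> * dist (x n) z"
        using z(2) by (intro tendsto_intros)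
      show "(\<lambda>m. f (x n) - f (x m)) \<longlonglongrightarrow> f (x n) - L"
        using L by (intro tendsto_intros)
    qed (use gap in blast)
    then show ?thesis using zL z(1) by (simp add: T_def)
  qed
  show ?thesis
  proof
    show "z \<in> S" by (fact z(1))
    show "f z + \<epsilon> * dist x0 z \<le> f x0"
      using zT[of 0] by (simp add: T_def x_0)
    fix y assume y: "y \<in> S"
    show "f z - \<epsilon> * dist z y \<le> f y"
    proof (rule ccontr)
      assume less: "\<not> ?thesis"
      then have yT: "y \<in> T (x n)" for n
        using T_trans[OF zT] y by (simp add: T_def)
      have "L \<le> f y + 0"
      proof (rule LIMSEQ_le_const)
        show "(\<lambda>n. f y + 1 / (real n + 1)) \<longlonglongrightarrow> f y + 0"
          using LIMSEQ_inverse_real_of_nat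
          by (intro tendsto_intros) (simp add: inverse_eq_divide add.commute)
        show "\<exists>N. \<forall>n\<ge>N. L \<le> f y + 1 / (real n + 1)"
          using Lle xmin[OF yT] order_trans by blast
      qed
      moreover have "0 \<le> \<epsilon> * dist z y" using \<epsilon> by simp
      ultimately show False using less zL by linarith
    qed
  qed
qed

section \<open>Slopes and directions of descent\<close>

lemma has_real_derivative_along_line:
  fixes f :: "'a::real_normed_vector \<Rightarrow> real"
  assumes "f differentiable (at (z + s *\<^sub>R h))"
  shows "((\<lambda>t. f (z + t *\<^sub>R h)) has_real_derivative fderiv f (z + s *\<^sub>R h) h) (at s)"
proof -
  have "((\<lambda>t. z + t *\<^sub>R h) has_derivative (\<lambda>t. t *\<^sub>R h)) (at s)"
    by (auto intro!: derivative_eq_intros)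
  from has_derivative_compose[OF this has_derivative_fderiv[OF assms]]
  show ?thesis
    by (simp add: has_field_derivative_def blinfun.scaleR_right mult.commute[of _ "fderiv f _ h"])
qed

text \<open>
  This turns the conclusion of Ekeland's principle into a derivative bound. One-sided difference
  quotients in the directions \<open>h\<close> and \<open>- h\<close> suffice, since the derivative is linear.
\<close>
lemma norm_fderiv_le_slope:
  fixes f :: "'a::real_normed_vector \<Rightarrow> real"
  assumes diff: "f differentiable (at z)" and \<epsilon>: "\<epsilon> \<ge> 0"
    and slope: "\<forall>\<^sub>F x in nhds z. f z - \<epsilon> * dist z x \<le> f x"
  shows "norm (fderiv f z) \<le> \<epsilon>"
proof -
  have lower: "- \<epsilon> * norm h \<le> fderiv f z h" for h
  proof -
    have "((\<lambda>t. f (z + t *\<^sub>R h)) has_real_derivative fderiv f z h) (at 0)"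
      using has_real_derivative_along_line[of f z 0 h] diff by simp
    then have "((\<lambda>t. (f (z + t *\<^sub>R h) - f z) / t) \<longlongrightarrow> fderiv f z h) (at_right 0)"
      by (auto simp: has_field_derivative_iff intro: filterlim_mono at_within_le_at
          dest: tendsto_within_subset)
    moreover have "\<forall>\<^sub>F t in at_right 0. - \<epsilon> * norm h \<le> (f (z + t *\<^sub>R h) - f z) / t"
    proof -
      have "((\<lambda>t. z + t *\<^sub>R h) \<longlongrightarrow> z + 0 *\<^sub>R h) (at_right 0)"
        by (intro tendsto_intros)
      then have "filterlim (\<lambda>t. z + t *\<^sub>R h) (nhds z) (at_right 0)" by simp
      from eventually_compose_filterlim[OF slope this] 
      show ?thesis using eventually_at_right_less[of "0::real"]
        by eventually_elim (simp add: dist_norm field_simps)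
    qed
    ultimately show ?thesis
      by (intro tendsto_lowerbound) auto
  qed
  show ?thesis
  proof (rule norm_blinfun_bound[OF \<epsilon>])
    fix h show "norm (fderiv f z h) \<le> \<epsilon> * norm h"
      using lower[of h] lower[of "- h"] by (simp add: blinfun.minus_right)
  qed
qed

lemma descent_direction:
  fixes D :: "'a::real_normed_vector \<Rightarrow>\<^sub>L real"
  assumes "norm D > \<epsilon>" "\<epsilon> \<ge> 0"
  obtains u where "norm u \<le> 1" "D u < - \<epsilon>"
proof -
  obtain h where h: "norm (D h) > \<epsilon> * norm h"
    using norm_blinfun_bound[of \<epsilon> D] assms by (meson not_le)
  then have "norm h > 0" using assms(2) by (cases "h = 0") auto
  define s where "s = - sgn (D h) / norm h"
  show ?thesis
  proof
    show "norm (s *\<^sub>R h) \<le> 1"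
      using \<open>norm h > 0\<close> by (simp add: s_def abs_sgn_eq)
    have "D (s *\<^sub>R h) = - \<bar>D h\<bar> / norm h"
      by (simp add: s_def blinfun.scaleR_right blinfun.minus_right abs_sgn mult.commute)
    then show "D (s *\<^sub>R h) < - \<epsilon>"
      using h \<open>norm h > 0\<close> by (simp add: less_divide_eq)
  qed
qed

text \<open>
  A direction of descent at one point of \<open>K\<close> still descends nearby, and averages of directions of
  descent descend, so finitely many local choices can be glued by weights. No partition of unity
  has to be constructed: the amount by which \<open>D s (u t)\<close> lies below \<open>- \<epsilon>\<close> is itself a continuous
  weight that vanishes exactly where \<open>u t\<close> is not good enough. The set \<open>C\<close> is where the field must
  vanish; later these are the end points of the paths.
\<close>
lemma continuous_descent_field:
  fixes D :: "'t::euclidean_space \<Rightarrow> 'a::real_normed_vector \<Rightarrow>\<^sub>L real"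
  assumes D: "continuous_on UNIV D" and K: "compact K" "K \<noteq> {}" and C: "closed C" "K \<inter> C = {}"
    and \<epsilon>: "\<epsilon> \<ge> 0" and large: "\<And>t. t \<in> K \<Longrightarrow> norm (D t) > \<epsilon>"
  obtains v where "continuous_on UNIV v" "\<And>t. norm (v t) \<le> 1"
    "\<And>t. t \<in> K \<Longrightarrow> D t (v t) < - \<epsilon>" "\<And>t. t \<in> C \<Longrightarrow> v t = 0"
proof -
  have "\<forall>t\<in>K. \<exists>u. norm u \<le> 1 \<and> D t u < - \<epsilon>"
    using descent_direction[OF large \<epsilon>] by metis
  then obtain u where u: "\<And>t. t \<in> K \<Longrightarrow> norm (u t) \<le> 1" "\<And>t. t \<in> K \<Longrightarrow> D t (u t) < - \<epsilon>"
    by metis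
  define w where "w t s = max 0 (- \<epsilon> - D s (u t))" for t s
  have w_cont: "continuous_on UNIV (w t)" for t
    unfolding w_def by (intro continuous_intros D)
  have w_nonneg: "w t s \<ge> 0" for t s by (simp add: w_def)
  have w_val: "w t s * D s (u t) \<le> - \<epsilon> * w t s" for t s
  proof (cases "D s (u t) \<le> - \<epsilon>")
    case True
    from mult_left_mono[OF this w_nonneg[of t s]] show ?thesis by (simp add: mult.commute)
  qed (simp add: w_def)
  have w_val_less: "w t s * D s (u t) < - \<epsilon> * w t s" if "w t s > 0" for t s
  proof -
    have "D s (u t) < - \<epsilon>" using that by (simp add: w_def max_def split: if_splits)
    from mult_strict_left_mono[OF this that] show ?thesis by (simp add: mult.commute)
  qed
  have "open {s. w t s > 0}" for t
    using w_cont by (intro open_Collect_less) (auto intro: continuous_intros)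
  moreover have "K \<subseteq> (\<Union>t\<in>K. {s. w t s > 0})"
    using u(2) by (force simp: w_def)
  ultimately obtain T where T: "T \<subseteq> K" "finite T" "K \<subseteq> (\<Union>t\<in>T. {s. w t s > 0})"
    using compactE_image[OF K(1)] by metis
  define W where "W s = (\<Sum>t\<in>T. w t s)" for s
  have W_cont: "continuous_on UNIV W"
    unfolding W_def by (intro continuous_on_sum w_cont)
  have W_pos: "W s > 0" if "s \<in> K" for s
  proof -
    obtain t where "t \<in> T" "w t s > 0" using T(3) \<open>s \<in> K\<close> by auto
    then show ?thesis unfolding W_def
      using T(2) w_nonneg by (intro sum_pos2) auto
  qed
  obtain s0 where s0: "s0 \<in> K" "\<And>s. s \<in> K \<Longrightarrow> W s0 \<le> W s"
    using continuous_attains_inf[OF K continuous_on_subset[OF W_cont subset_UNIV]] by blast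
  \<comment> \<open>Dividing by \<open>max \<mu> (W s)\<close> instead of \<open>W s\<close> changes nothing on \<open>K\<close>, but keeps the field
    continuous and of norm at most one where all weights vanish.\<close>
  define \<mu> where "\<mu> = W s0"
  have \<mu>: "\<mu> > 0" using W_pos[OF s0(1)] by (simp add: \<mu>_def)
  obtain \<omega> :: "'t \<Rightarrow> real" where \<omega>: "continuous_on UNIV \<omega>"
    "\<And>t. \<omega> t \<in> closed_segment 1 0" "\<And>t. t \<in> K \<Longrightarrow> \<omega> t = 1" "\<And>t. t \<in> C \<Longrightarrow> \<omega> t = 0"
    using Urysohn[OF compact_imp_closed[OF K(1)] C, of 1 0] by metis
  have \<omega>01: "0 \<le> \<omega> t" "\<omega> t \<le> 1" for t
    using \<omega>(2)[of t] by (auto simp: closed_segment_eq_real_ivl)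
  define v where "v s = (\<omega> s / max \<mu> (W s)) *\<^sub>R (\<Sum>t\<in>T. w t s *\<^sub>R u t)" for s
  show ?thesis
  proof
    show "continuous_on UNIV v"
      unfolding v_def using \<mu>
      by (intro continuous_intros \<omega>(1) W_cont w_cont) (auto simp: max_def)
    fix s
    show "norm (v s) \<le> 1"
    proof -
      have "norm (\<Sum>t\<in>T. w t s *\<^sub>R u t) \<le> (\<Sum>t\<in>T. w t s)"
        using T(1) u(1) w_nonneg by (intro sum_norm_le) (auto simp: mult_left_le)
      also have "\<dots> \<le> max \<mu> (W s)" by (simp add: W_def)
      finally have "norm (\<Sum>t\<in>T. w t s *\<^sub>R u t) / max \<mu> (W s) \<le> 1" 
        using \<mu> by (simp add: divide_le_eq)
      then have "\<omega> s * (norm (\<Sum>t\<in>T. w t s *\<^sub>R u t) / max \<mu> (W s)) \<le> 1"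
        using \<omega>01[of s] \<mu> by (intro mult_le_one) auto
      then show ?thesis using \<omega>01[of s] \<mu> by (simp add: v_def)
    qed
    show "v s = 0" if "s \<in> C" using \<omega>(4)[OF that] by (simp add: v_def)
    show "D s (v s) < - \<epsilon>" if "s \<in> K"
    proof -
      have "max \<mu> (W s) = W s" using s0(2)[OF that] by (simp add: \<mu>_def)
      then have eq: "D s (v s) = (\<Sum>t\<in>T. w t s * D s (u t)) / W s"
        using \<omega>(3)[OF that] by (simp add: v_def blinfun.scaleR_right blinfun.sum_right)
      obtain t where t: "t \<in> T" "w t s > 0" using T(3) \<open>s \<in> K\<close> by auto
      have "(\<Sum>t\<in>T. w t s * D s (u t)) < (\<Sum>t\<in>T. - \<epsilon> * w t s)"
        using t w_val_less w_val by (intro sum_strict_mono_ex1 T(2)) auto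
      also have "\<dots> = - \<epsilon> * W s" by (simp only: W_def sum_distrib_left)
      finally show ?thesis
        unfolding eq using W_pos[OF that] by (simp add: divide_less_eq)
    qed
  qed
qed


section \<open>Almost critical points from the mountain pass geometry\<close>

lemma C1_functional_imp_continuous:
  assumes "C1_functional f"
  shows "continuous_on S f"
  using assms unfolding C1_functional_def
  by (auto intro!: continuous_at_imp_continuous_on differentiable_imp_continuous_within)

lemma continuous_on_eval_bcontfun:
  "continuous_on UNIV (\<lambda>\<gamma>::'t::topological_space \<Rightarrow>\<^sub>C 'a::metric_space. apply_bcontfun \<gamma> t)"
  unfolding continuous_on_iff using dist_fun_lt_imp_dist_val_lt by blast

text \<open>
  Let \<open>F \<gamma>\<close> be the maximum of \<open>f\<close> along a path \<open>\<gamma>\<close> from \<open>a\<close> to \<open>b\<close>. Every path crosses the sphere,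
  so \<open>F \<ge> m\<close>, and Ekeland's principle gives a path from which \<open>F\<close> cannot decrease at a rate
  above \<open>\<epsilon>\<close>. At some highest point of that path the derivative has norm at most \<open>\<epsilon>\<close>: otherwise
  the path could be pushed down along a continuous field of descent directions, and \<open>F\<close> would
  decrease faster. Since the principle can be started at any one fixed path, whose height is then
  the bound \<open>B\<close> for all \<open>\<epsilon>\<close>, the minimax level itself does not enter.

  Paths are modelled as bounded continuous functions on all of \<open>real\<close>, a type that is already a
  complete normed space; only their values on the unit interval enter \<open>F\<close>.
\<close>
lemma mountain_pass_almost_critical:
  fixes f :: "'a::banach \<Rightarrow> real"
  assumes C1: "C1_functional f" and r: "0 < r" "r < dist a b"
    and ridge: "\<And>x. x \<in> sphere a r \<Longrightarrow> m \<le> f x" and low: "f a < m" "f b < m"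
  obtains B where "\<And>\<epsilon>. \<epsilon> > 0 \<Longrightarrow> \<exists>y. m \<le> f y \<and> f y \<le> B \<and> norm (fderiv f y) \<le> \<epsilon>"
proof -
  have diff: "f differentiable (at x)" for x
    using C1 by (simp add: C1_functional_def)
  have f_cont: "continuous_on UNIV f"
    by (rule C1_functional_imp_continuous[OF C1])
  have f'_cont: "continuous_on UNIV (fderiv f)"
    using C1 by (simp add: C1_functional_def)
  define \<Gamma> where "\<Gamma> = {\<gamma> :: real \<Rightarrow>\<^sub>C 'a. \<gamma> 0 = a \<and> \<gamma> 1 = b}"
  define F where "F \<gamma> = (SUP t\<in>{0..1}. f (apply_bcontfun \<gamma> t))" for \<gamma> :: "real \<Rightarrow>\<^sub>C 'a"
  have f\<gamma>_cont: "continuous_on T (\<lambda>t. f (apply_bcontfun \<gamma> t))" for \<gamma> :: "real \<Rightarrow>\<^sub>C 'a" and T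
    by (rule continuous_on_compose2[OF f_cont]) auto
  have le_F: "f (apply_bcontfun \<gamma> t) \<le> F \<gamma>" if "t \<in> {0..1}" for \<gamma> t
    unfolding F_def using that f\<gamma>_cont
    by (intro cSUP_upper bounded_imp_bdd_above compact_imp_bounded compact_continuous_image) auto
  have F_attained: "\<exists>t\<in>{0..1}. f (apply_bcontfun \<gamma> t) = F \<gamma>" for \<gamma>
  proof -
    obtain t where t: "t \<in> {0..1}" "\<And>s. s \<in> {0..1} \<Longrightarrow> f (apply_bcontfun \<gamma> s) \<le> f (apply_bcontfun \<gamma> t)"
      using continuous_attains_sup[of "{0..1::real}" "\<lambda>t. f (apply_bcontfun \<gamma> t)"] f\<gamma>_cont by auto
    then have "F \<gamma> \<le> f (apply_bcontfun \<gamma> t)"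
      unfolding F_def by (intro cSUP_least) auto
    with le_F[OF t(1)] t(1) show ?thesis by (metis order_antisym)
  qed
  have F_le_iff: "F \<gamma> \<le> A \<longleftrightarrow> (\<forall>t\<in>{0..1}. f (apply_bcontfun \<gamma> t) \<le> A)" for \<gamma> A
    using le_F F_attained by (metis order_trans)
  have \<Gamma>_closed: "closed \<Gamma>"
    unfolding \<Gamma>_def
    by (intro closed_Collect_conj closed_Collect_eq continuous_on_eval_bcontfun continuous_on_const)
  have lsc: "closed {\<gamma> \<in> \<Gamma>. F \<gamma> \<le> A}" for A
  proof -
    have "closed {\<gamma> :: real \<Rightarrow>\<^sub>C 'a. f (\<gamma> t) \<le> A}" for t
      by (intro closed_Collect_le continuous_on_const
          continuous_on_compose2[OF f_cont continuous_on_eval_bcontfun]) auto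
    then have "closed (\<Gamma> \<inter> (\<Inter>t\<in>{0..1}. {\<gamma> :: real \<Rightarrow>\<^sub>C 'a. f (\<gamma> t) \<le> A}))"
      using \<Gamma>_closed by (intro closed_Int closed_INT) auto
    also have "\<Gamma> \<inter> (\<Inter>t\<in>{0..1}. {\<gamma> :: real \<Rightarrow>\<^sub>C 'a. f (\<gamma> t) \<le> A}) = {\<gamma> \<in> \<Gamma>. F \<gamma> \<le> A}"
      by (auto simp: F_le_iff)
    finally show ?thesis .
  qed
  have m_le_F: "m \<le> F \<gamma>" if "\<gamma> \<in> \<Gamma>" for \<gamma>
  proof -
    have "\<exists>t\<ge>0. t \<le> 1 \<and> dist a (apply_bcontfun \<gamma> t) = r"
      using that r by (intro IVT') (auto simp: \<Gamma>_def intro!: continuous_intros)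
    then obtain t where "t \<in> {0..1}" "apply_bcontfun \<gamma> t \<in> sphere a r" by auto
    then show ?thesis using ridge le_F order_trans by metis
  qed
  obtain \<gamma>\<^sub>0 where \<gamma>\<^sub>0: "\<gamma>\<^sub>0 \<in> \<Gamma>"
  proof -
    define g where "g t = a + (max 0 (min 1 t)) *\<^sub>R (b - a)" for t :: real
    have "g \<in> bcontfun"
    proof (rule bcontfun_normI)
      show "continuous_on UNIV g" unfolding g_def by (intro continuous_intros)
      fix t
      have "norm (g t) \<le> norm a + \<bar>max 0 (min 1 t)\<bar> * norm (b - a)"
        unfolding g_def by (metis norm_scaleR norm_triangle_ineq)
      also have "\<dots> \<le> norm a + 1 * norm (b - a)"
        by (intro add_left_mono mult_right_mono) auto
      finally show "norm (g t) \<le> norm a + norm (b - a)" by simp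
    qed
    then obtain \<gamma> where "g = apply_bcontfun \<gamma>" by (rule bcontfunE)
    then have "apply_bcontfun \<gamma> t = g t" for t by simp
    then have "\<gamma> \<in> \<Gamma>" by (simp add: \<Gamma>_def g_def)
    then show ?thesis by (rule that)
  qed
  have main: "\<exists>y. m \<le> f y \<and> f y \<le> F \<gamma>\<^sub>0 \<and> norm (fderiv f y) \<le> \<epsilon>" if \<epsilon>: "\<epsilon> > 0" for \<epsilon>
  proof -
    obtain \<gamma> where \<gamma>: "\<gamma> \<in> \<Gamma>" and \<gamma>_le: "F \<gamma> + \<epsilon> * dist \<gamma>\<^sub>0 \<gamma> \<le> F \<gamma>\<^sub>0"
      and min: "\<And>\<eta>. \<eta> \<in> \<Gamma> \<Longrightarrow> F \<gamma> - \<epsilon> * dist \<gamma> \<eta> \<le> F \<eta>"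
      using ekeland_variational_principle[where S = \<Gamma> and f = F and b = m, OF _ \<gamma>\<^sub>0 \<epsilon> m_le_F lsc]
        \<Gamma>_closed by (metis complete_eq_closed)
    have F\<gamma>: "F \<gamma> \<le> F \<gamma>\<^sub>0"
      using \<gamma>_le \<epsilon> by (smt (verit) mult_nonneg_nonneg zero_le_dist)
    define K where "K = {t \<in> {0..1}. f (apply_bcontfun \<gamma> t) = F \<gamma>}"
    have "\<exists>t\<in>K. norm (fderiv f (apply_bcontfun \<gamma> t)) \<le> \<epsilon>"
    proof (rule ccontr)
      assume "\<not> ?thesis"
      then have large: "\<And>t. t \<in> K \<Longrightarrow> norm (fderiv f (apply_bcontfun \<gamma> t)) > \<epsilon>" by force
      have "closed {t. f (apply_bcontfun \<gamma> t) = F \<gamma>}"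
        by (intro closed_Collect_eq f\<gamma>_cont continuous_on_const)
      then have "compact ({0..1} \<inter> {t. f (apply_bcontfun \<gamma> t) = F \<gamma>})"
        by (intro compact_Int_closed) auto
      then have K: "compact K" by (simp add: K_def Int_def)
      have K_ne: "K \<noteq> {}" using F_attained[of \<gamma>] by (auto simp: K_def)
      have K_ends: "K \<inter> {0, 1} = {}"
        using \<gamma> low m_le_F[OF \<gamma>] by (auto simp: K_def \<Gamma>_def)
      have D_cont: "continuous_on UNIV (\<lambda>t. fderiv f (apply_bcontfun \<gamma> t))"
        by (rule continuous_on_compose2[OF f'_cont]) auto
      obtain v where v_cont: "continuous_on UNIV v" and v_norm: "\<And>t. norm (v t) \<le> 1"
        and v_desc: "\<And>t. t \<in> K \<Longrightarrow> fderiv f (apply_bcontfun \<gamma> t) (v t) < - \<epsilon>"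
        and v_ends: "\<And>t. t \<in> {0, 1} \<Longrightarrow> v t = 0"
        using continuous_descent_field[OF D_cont K K_ne _ K_ends _ large] \<epsilon>
        by (metis finite.emptyI finite.insertI finite_imp_closed less_imp_le)
      obtain V where V: "v = apply_bcontfun V"
        using bcontfun_normI[OF v_cont v_norm] by (rule bcontfunE)
      define h where "h n = inverse (real (Suc n))" for n
      have h: "h n > 0" for n by (simp add: h_def)
      have h_lim: "h \<longlonglongrightarrow> 0"
        unfolding h_def by (rule LIMSEQ_inverse_real_of_nat)
      \<comment> \<open>Push \<open>\<gamma>\<close> by \<open>h n\<close> along the field. At a highest point of the new path \<open>f\<close> dropped by at
        most \<open>\<epsilon> * h n\<close>, so by the mean value theorem its slope was at least \<open>- \<epsilon>\<close> on the way.\<close>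
      have "\<exists>t \<theta>. t \<in> {0..1} \<and> 0 < \<theta> \<and> \<theta> < h n
          \<and> F \<gamma> - \<epsilon> * h n \<le> f (apply_bcontfun \<gamma> t + h n *\<^sub>R v t)
          \<and> - \<epsilon> \<le> fderiv f (apply_bcontfun \<gamma> t + \<theta> *\<^sub>R v t) (v t)" for n
      proof -
        define \<eta> where "\<eta> = \<gamma> + h n *\<^sub>R V"
        have \<eta>_val: "apply_bcontfun \<eta> t = apply_bcontfun \<gamma> t + h n *\<^sub>R v t" for t
          by (simp add: \<eta>_def V)
        have "\<eta> \<in> \<Gamma>" using \<gamma> v_ends by (simp add: \<Gamma>_def \<eta>_val)
        moreover have "dist \<gamma> \<eta> \<le> h n"
          using v_norm h[of n] by (intro dist_bound) (simp add: \<eta>_val dist_norm mult_left_le)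
        ultimately have F\<eta>: "F \<gamma> - \<epsilon> * h n \<le> F \<eta>"
          using min[of \<eta>] \<epsilon> by (smt (verit) mult_left_mono)
        obtain t where t: "t \<in> {0..1}" "f (apply_bcontfun \<eta> t) = F \<eta>"
          using F_attained by blast
        obtain \<theta> where \<theta>: "0 < \<theta>" "\<theta> < h n"
          "f (apply_bcontfun \<gamma> t + h n *\<^sub>R v t) - f (apply_bcontfun \<gamma> t + 0 *\<^sub>R v t)
            = (h n - 0) * fderiv f (apply_bcontfun \<gamma> t + \<theta> *\<^sub>R v t) (v t)"
          using MVT2[OF h[of n], of "\<lambda>s. f (apply_bcontfun \<gamma> t + s *\<^sub>R v t)"
            "\<lambda>s. fderiv f (apply_bcontfun \<gamma> t + s *\<^sub>R v t) (v t)"]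
            has_real_derivative_along_line[OF diff] by blast
        have "h n * (- \<epsilon>) \<le> h n * fderiv f (apply_bcontfun \<gamma> t + \<theta> *\<^sub>R v t) (v t)"
          using \<theta>(3) le_F[OF t(1), of \<gamma>] F\<eta> t(2) by (simp add: \<eta>_val mult.commute)
        then have "- \<epsilon> \<le> fderiv f (apply_bcontfun \<gamma> t + \<theta> *\<^sub>R v t) (v t)"
          using h[of n] by (simp only: mult_le_cancel_left_pos)
        then show ?thesis
          using t \<theta>(1,2) F\<eta> by (metis \<eta>_val)
      qed
      then obtain t \<theta> where t: "\<And>n. t n \<in> {0..1}" and \<theta>: "\<And>n. 0 < \<theta> n" "\<And>n. \<theta> n < h n"
        and val: "\<And>n. F \<gamma> - \<epsilon> * h n \<le> f (apply_bcontfun \<gamma> (t n) + h n *\<^sub>R v (t n))"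
        and der: "\<And>n. - \<epsilon> \<le> fderiv f (apply_bcontfun \<gamma> (t n) + \<theta> n *\<^sub>R v (t n)) (v (t n))"
        by metis
      obtain t\<^sub>0 k where t\<^sub>0: "t\<^sub>0 \<in> {0..1}" and k: "strict_mono k" and tk: "(t \<circ> k) \<longlonglongrightarrow> t\<^sub>0"
        using compact_Icc[of "0::real" 1] t unfolding compact_def by metis
      have hk: "(\<lambda>n. h (k n)) \<longlonglongrightarrow> 0"
        using LIMSEQ_subseq_LIMSEQ[OF h_lim k] by (simp add: o_def)
      have \<theta>k: "(\<lambda>n. \<theta> (k n)) \<longlonglongrightarrow> 0"
        by (rule tendsto_sandwich[OF _ _ tendsto_const hk])
          (use \<theta> in \<open>auto intro!: always_eventually less_imp_le\<close>)
      have \<gamma>k: "(\<lambda>n. apply_bcontfun \<gamma> (t (k n))) \<longlonglongrightarrow> apply_bcontfun \<gamma> t\<^sub>0"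
        using continuous_on_tendsto_compose[OF continuous_on_apply_bcontfun[of UNIV \<gamma>] tk]
        by (simp add: o_def)
      have vk: "(\<lambda>n. v (t (k n))) \<longlonglongrightarrow> v t\<^sub>0"
        using continuous_on_tendsto_compose[OF v_cont tk] by (simp add: o_def)
      have move: "(\<lambda>n. apply_bcontfun \<gamma> (t (k n)) + c n *\<^sub>R v (t (k n))) \<longlonglongrightarrow> apply_bcontfun \<gamma> t\<^sub>0"
        if "c \<longlonglongrightarrow> 0" for c
        using tendsto_add[OF \<gamma>k tendsto_scaleR[OF that vk]] by simp
      \<comment> \<open>The limit parameter is a highest point of \<open>\<gamma>\<close> at which the slope along the field is still
        at least \<open>- \<epsilon>\<close>, which contradicts the choice of the field.\<close>
      have "F \<gamma> \<le> f (apply_bcontfun \<gamma> t\<^sub>0)"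
      proof (rule LIMSEQ_le)
        show "(\<lambda>n. F \<gamma> - \<epsilon> * h (k n)) \<longlonglongrightarrow> F \<gamma>"
          using tendsto_diff[OF tendsto_const tendsto_mult[OF tendsto_const hk]] by simp
        show "(\<lambda>n. f (apply_bcontfun \<gamma> (t (k n)) + h (k n) *\<^sub>R v (t (k n))))
            \<longlonglongrightarrow> f (apply_bcontfun \<gamma> t\<^sub>0)"
          using continuous_on_tendsto_compose[OF f_cont move[OF hk]] by simp
      qed (use val in blast)
      with le_F[OF t\<^sub>0, of \<gamma>] t\<^sub>0 have "t\<^sub>0 \<in> K" by (simp add: K_def)
      moreover have "- \<epsilon> \<le> fderiv f (apply_bcontfun \<gamma> t\<^sub>0) (v t\<^sub>0)"
      proof (rule LIMSEQ_le_const)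
        have "(\<lambda>n. fderiv f (apply_bcontfun \<gamma> (t (k n)) + \<theta> (k n) *\<^sub>R v (t (k n))))
            \<longlonglongrightarrow> fderiv f (apply_bcontfun \<gamma> t\<^sub>0)"
          using continuous_on_tendsto_compose[OF f'_cont move[OF \<theta>k]] by simp
        from blinfun.tendsto[OF this vk]
        show "(\<lambda>n. fderiv f (apply_bcontfun \<gamma> (t (k n)) + \<theta> (k n) *\<^sub>R v (t (k n))) (v (t (k n))))
            \<longlonglongrightarrow> fderiv f (apply_bcontfun \<gamma> t\<^sub>0) (v t\<^sub>0)" .
      qed (use der in blast)
      ultimately show False using v_desc by fastforce
    qed
    then obtain t where "t \<in> K" "norm (fderiv f (apply_bcontfun \<gamma> t)) \<le> \<epsilon>" by blast
    then show ?thesis using m_le_F[OF \<gamma>] F\<gamma> unfolding K_def by force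
  qed
  show ?thesis by (rule that[OF main])
qed

section \<open>Passing to the approximating functionals\<close>

text \<open>
  On a ball of radius \<open>\<rho>\<close> on which \<open>f\<close> is nearly affine, \<open>f\<close> falls by at most \<open>2 * \<delta> * \<rho>\<close> below
  its value at the centre, and \<open>g n\<close> by at most \<open>4 * \<delta> * \<rho>\<close> once it is within \<open>\<delta> * \<rho>\<close> of \<open>f\<close>.
  Ekeland's principle with the rate \<open>8 * \<delta>\<close> then stops within distance \<open>\<rho> / 2\<close> of the centre,
  hence at an interior point of the ball, where the rate bounds the derivative.
\<close>
lemma uniform_limit_almost_critical:
  fixes f :: "'a::banach \<Rightarrow> real" and g :: "nat \<Rightarrow> 'a \<Rightarrow> real"
  assumes f: "C1_functional f" and g: "\<And>n. C1_functional (g n)"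
    and unif: "uniform_limit UNIV g f sequentially"
    and small: "norm (fderiv f y) \<le> \<delta>" and \<delta>: "\<delta> > 0" and \<sigma>: "\<sigma> > 0"
  shows "\<forall>\<^sub>F n in sequentially. \<exists>z. dist y z < \<sigma> \<and> \<bar>g n z - f y\<bar> < \<sigma> \<and> norm (fderiv (g n) z) \<le> 8 * \<delta>"
proof -
  have "(f has_derivative fderiv f y) (at y)"
    using f by (intro has_derivative_fderiv) (simp add: C1_functional_def)
  then obtain d where d: "d > 0"
    and lin: "\<And>x. dist y x < d \<Longrightarrow> \<bar>f x - f y - fderiv f y (x - y)\<bar> \<le> \<delta> * norm (x - y)"
    unfolding has_derivative_at_alt using \<delta> by (force simp: dist_norm norm_minus_commute)
  have near: "f y - 2 * \<delta> * dist y x \<le> f x" "f x \<le> f y + 2 * \<delta> * dist y x" if "dist y x < d" for x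
  proof -
    have "\<bar>fderiv f y (x - y)\<bar> \<le> \<delta> * norm (x - y)"
      using norm_blinfun[of "fderiv f y" "x - y"] small
      by (smt (verit) mult_right_mono norm_ge_zero real_norm_def)
    with lin[OF that] show "f y - 2 * \<delta> * dist y x \<le> f x" "f x \<le> f y + 2 * \<delta> * dist y x"
      by (simp_all add: dist_norm norm_minus_commute)
  qed
  \<comment> \<open>The bound \<open>\<sigma> / (4 * \<delta>)\<close> keeps the change of values, at most \<open>2 * \<delta> * \<rho>\<close>, below \<open>\<sigma>\<close>.\<close>
  define \<rho> where "\<rho> = Min {d / 2, \<sigma> / 2, \<sigma> / (4 * \<delta>)}"
  have \<rho>: "\<rho> > 0" "\<rho> < d" "\<rho> < \<sigma>" "\<delta> * \<rho> * 4 \<le> \<sigma>"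
  proof -
    show "\<rho> > 0" "\<rho> < d" "\<rho> < \<sigma>" using d \<sigma> \<delta> by (auto simp: \<rho>_def)
    have "\<rho> \<le> \<sigma> / (4 * \<delta>)" by (simp add: \<rho>_def)
    then show "\<delta> * \<rho> * 4 \<le> \<sigma>" using \<delta> by (simp add: field_simps)
  qed
  have "\<forall>\<^sub>F n in sequentially. \<forall>x\<in>UNIV. dist (g n x) (f x) < \<delta> * \<rho>"
    using uniform_limitD[OF unif] \<delta> \<rho>(1) by simp
  then show ?thesis
  proof eventually_elim
    fix n assume "\<forall>x\<in>UNIV. dist (g n x) (f x) < \<delta> * \<rho>"
    then have close: "\<bar>g n x - f x\<bar> < \<delta> * \<rho>" for x by (simp add: dist_real_def)
    have on_ball: "g n y - 4 * \<delta> * \<rho> \<le> g n x" if "x \<in> cball y \<rho>" for x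
    proof -
      have "2 * \<delta> * dist y x \<le> 2 * \<delta> * \<rho>" using that \<delta> by simp
      then show ?thesis
        using near(1)[of x] that \<rho>(2) close[of x] close[of y] by simp
    qed
    obtain z where z: "z \<in> cball y \<rho>" "g n z + 8 * \<delta> * dist y z \<le> g n y"
      "\<And>x. x \<in> cball y \<rho> \<Longrightarrow> g n z - 8 * \<delta> * dist z x \<le> g n x"
    proof (rule ekeland_variational_principle[of "cball y \<rho>" y "8 * \<delta>" "g n y - 4 * \<delta> * \<rho>" "g n"])
      show "complete (cball y \<rho>)" by (simp add: complete_eq_closed)
      show "closed {x \<in> cball y \<rho>. g n x \<le> c}" for c
        using closed_Int[OF closed_cball closed_Collect_le[OF C1_functional_imp_continuous[OF g, of UNIV n]
              continuous_on_const]]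
        by (simp add: Int_def)
    qed (use \<delta> \<rho>(1) on_ball in auto)
    have "8 * \<delta> * dist y z \<le> 4 * \<delta> * \<rho>" using z(2) on_ball[OF z(1)] by linarith
    then have half: "dist y z \<le> \<rho> / 2" using \<delta> by (simp add: field_simps)
    have "norm (fderiv (g n) z) \<le> 8 * \<delta>"
    proof (rule norm_fderiv_le_slope)
      show "g n differentiable at z" using g by (simp add: C1_functional_def)
      have "z \<in> ball y \<rho>" using half \<rho>(1) by simp
      then have "\<forall>\<^sub>F x in nhds z. x \<in> ball y \<rho>"
        by (intro eventually_nhds_in_open) auto
      then show "\<forall>\<^sub>F x in nhds z. g n z - 8 * \<delta> * dist z x \<le> g n x"
        by eventually_elim (simp add: z(3))
    qed (use \<delta> in simp)
    moreover have "\<bar>g n z - f y\<bar> < \<sigma>"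
    proof -
      have "2 * \<delta> * dist y z \<le> 2 * \<delta> * (\<rho> / 2)"
        using half \<delta> by (intro mult_left_mono) auto
      then show ?thesis
        using near[of z] half \<rho> close[of z] by (simp add: abs_less_iff)
    qed
    ultimately show "\<exists>z. dist y z < \<sigma> \<and> \<bar>g n z - f y\<bar> < \<sigma> \<and> norm (fderiv (g n) z) \<le> 8 * \<delta>"
      using half \<rho> by (intro exI[of _ z]) auto
  qed
qed

text \<open>
  Hypotheses on sequences \<open>x n\<close> paired with the \<open>n\<close>-th functional must be fed one point for every
  \<open>n\<close>. Here \<open>\<kappa> n\<close> is the best index \<open>k \<le> n\<close> whose property already holds from \<open>n\<close> on.
\<close>
lemma diagonal_eventually:
  assumes "\<And>k::nat. \<forall>\<^sub>F n in sequentially. P k n"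
  obtains \<kappa> :: "nat \<Rightarrow> nat"
  where "filterlim \<kappa> at_top sequentially" "\<forall>\<^sub>F n in sequentially. P (\<kappa> n) n"
proof -
  obtain N where N: "\<And>k n. N k \<le> n \<Longrightarrow> P k n"
    using assms unfolding eventually_sequentially by metis
  define \<kappa> where "\<kappa> n = Max {k. k \<le> n \<and> N k \<le> n}" for n
  show ?thesis
  proof
    show "filterlim \<kappa> at_top sequentially"
      unfolding filterlim_at_top eventually_sequentially
    proof (intro allI exI impI)
      fix k n assume "max k (N k) \<le> n"
      then show "k \<le> \<kappa> n" unfolding \<kappa>_def by (intro Max_ge) auto
    qed
    have "P (\<kappa> n) n" if "N 0 \<le> n" for n
    proof -
      have "\<kappa> n \<in> {k. k \<le> n \<and> N k \<le> n}"
        unfolding \<kappa>_def using that by (intro Max_in) auto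
      then show ?thesis using N by simp
    qed
    then show "\<forall>\<^sub>F n in sequentially. P (\<kappa> n) n"
      unfolding eventually_sequentially by blast
  qed
qed

section \<open>A critical point of the limit functional\<close>

theorem theorem6:
  fixes \<Phi>n :: "nat \<Rightarrow> 'a::banach \<Rightarrow> real"
    and \<Phi> :: "'a \<Rightarrow> real"
    and r :: real
  assumes C1: "C1_functional \<Phi>" "\<And>n. C1_functional (\<Phi>n n)"
    and PS: "\<And>x :: nat \<Rightarrow> 'a.
      (SUP n. ereal \<bar>\<Phi>n n (x n)\<bar>) < \<infinity> \<Longrightarrow>
      (\<lambda>n. norm (fderiv (\<Phi>n n) (x n))) \<longlonglongrightarrow> 0 \<Longrightarrow>
      \<exists>k l. strict_mono k \<and> (x \<circ> k) \<longlonglongrightarrow> l"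
    and unif: "uniform_limit UNIV \<Phi>n \<Phi> sequentially"
    and zero: "\<And>n. \<Phi>n n 0 = 0"
    and r_pos: "r > 0"
    and sphere_pos: "(INF (x, n) \<in> sphere 0 r \<times> UNIV. ereal (\<Phi>n n x)) > 0"
    and far_point: "\<exists>xs. norm xs > r \<and> (SUP n. ereal (\<Phi>n n xs)) < 0"
  shows "\<exists>xbar. ereal (\<Phi> xbar) \<ge> (INF x \<in> sphere 0 r. ereal (\<Phi> x))
      \<and> (INF x \<in> sphere 0 r. ereal (\<Phi> x)) > 0
      \<and> fderiv \<Phi> xbar = 0"
proof -
  have pointwise: "(\<lambda>n. \<Phi>n n x) \<longlonglongrightarrow> \<Phi> x" for x
    using tendsto_uniform_limitI[OF unif] by simp
  obtain w where far: "norm w > r" and far_neg: "(SUP n. ereal (\<Phi>n n w)) < 0"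
    using far_point by metis
  have "\<Phi>n n w \<le> 0" for n
  proof -
    have "ereal (\<Phi>n n w) \<le> (SUP n. ereal (\<Phi>n n w))" by (rule SUP_upper) simp
    from le_less_trans[OF this far_neg] show ?thesis by simp
  qed
  then have \<Phi>_far: "\<Phi> w \<le> 0"
    using LIMSEQ_le_const2[OF pointwise] by blast
  have \<Phi>_0: "\<Phi> 0 = 0"
    using LIMSEQ_unique[OF pointwise[of 0]] by (simp add: zero)
  define I where "I = (INF x \<in> sphere 0 r. ereal (\<Phi> x))"
  \<comment> \<open>A real lower bound for all \<open>\<Phi>n n\<close> on the sphere survives the pointwise limit; together with
    one point of the sphere it shows that \<open>I\<close> is a positive real number.\<close>
  obtain m\<^sub>0 where m\<^sub>0: "ereal 0 < ereal m\<^sub>0"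
    "ereal m\<^sub>0 < (INF (x, n) \<in> sphere 0 r \<times> UNIV. ereal (\<Phi>n n x))"
    using ereal_dense2[OF sphere_pos] by (auto simp: zero_ereal_def)
  have "ereal m\<^sub>0 \<le> ereal (\<Phi> x)" if "x \<in> sphere 0 r" for x
  proof -
    have "ereal m\<^sub>0 \<le> ereal (\<Phi>n n x)" for n
      using order_trans[OF less_imp_le[OF m\<^sub>0(2)] INF_lower[of "(x, n)"]] that by simp
    then show ?thesis using LIMSEQ_le_const[OF pointwise] by simp
  qed
  then have m\<^sub>0_I: "ereal m\<^sub>0 \<le> I" unfolding I_def by (intro INF_greatest)
  have "(r / norm w) *\<^sub>R w \<in> sphere 0 r" using r_pos far by auto
  then have "I \<le> ereal (\<Phi> ((r / norm w) *\<^sub>R w))" unfolding I_def by (rule INF_lower)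
  with m\<^sub>0_I obtain m where m: "I = ereal m" by (cases I) auto
  have m_pos: "m > 0" using m\<^sub>0(1) m\<^sub>0_I m by simp
  have ridge: "m \<le> \<Phi> x" if "x \<in> sphere 0 r" for x
  proof -
    have "I \<le> ereal (\<Phi> x)" unfolding I_def using that by (rule INF_lower)
    then show ?thesis by (simp add: m)
  qed
  obtain B where "\<And>\<epsilon>. \<epsilon> > 0 \<Longrightarrow> \<exists>y. m \<le> \<Phi> y \<and> \<Phi> y \<le> B \<and> norm (fderiv \<Phi> y) \<le> \<epsilon>"
  proof (rule mountain_pass_almost_critical[OF C1(1) r_pos _ ridge])
    show "r < dist 0 w" "\<Phi> 0 < m" "\<Phi> w < m"
      using far \<Phi>_0 \<Phi>_far m_pos by simp_all
  qed auto
  then have "\<exists>y. m \<le> \<Phi> y \<and> \<Phi> y \<le> B \<and> norm (fderiv \<Phi> y) \<le> inverse (real (Suc k))" for k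
    by simp
  then obtain y where y: "\<And>k. m \<le> \<Phi> (y k)" "\<And>k. \<Phi> (y k) \<le> B"
    "\<And>k. norm (fderiv \<Phi> (y k)) \<le> inverse (real (Suc k))"
    by metis
  define P where "P k n z \<longleftrightarrow> dist (y k) z < inverse (real (Suc k))
      \<and> \<bar>\<Phi>n n z - \<Phi> (y k)\<bar> < inverse (real (Suc k))
      \<and> norm (fderiv (\<Phi>n n) z) \<le> 8 * inverse (real (Suc k))" for k n z
  have "\<forall>\<^sub>F n in sequentially. \<exists>z. P k n z" for k
    unfolding P_def by (rule uniform_limit_almost_critical[OF C1 unif y(3)]) simp_all
  then obtain \<kappa> where \<kappa>: "filterlim \<kappa> at_top sequentially"
    and P\<kappa>: "\<forall>\<^sub>F n in sequentially. \<exists>z. P (\<kappa> n) n z"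
    using diagonal_eventually[of "\<lambda>k n. \<exists>z. P k n z"] by blast
  define x where "x n = (SOME z. P (\<kappa> n) n z)" for n
  have x: "\<forall>\<^sub>F n in sequentially. P (\<kappa> n) n (x n)"
    using P\<kappa> by eventually_elim (auto simp: x_def intro: someI_ex)
  have inv_\<kappa>: "(\<lambda>n. inverse (real (Suc (\<kappa> n)))) \<longlonglongrightarrow> 0"
    using filterlim_compose[OF LIMSEQ_inverse_real_of_nat \<kappa>] .
  have "(SUP n. ereal \<bar>\<Phi>n n (x n)\<bar>) < \<infinity>"
  proof -
    have "\<forall>\<^sub>F n in sequentially. norm (\<Phi>n n (x n)) \<le> B + 1"
      using x
    proof eventually_elim
      fix n assume "P (\<kappa> n) n (x n)"
      moreover have "inverse (real (Suc (\<kappa> n))) \<le> 1" by (simp add: inverse_le_1_iff)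
      ultimately show "norm (\<Phi>n n (x n)) \<le> B + 1"
        using y(1,2)[of "\<kappa> n"] m_pos unfolding P_def by (simp add: abs_le_iff abs_less_iff)
    qed
    then have "Bseq (\<lambda>n. \<Phi>n n (x n))" by (rule BfunI)
    then obtain A where "\<And>n. norm (\<Phi>n n (x n)) \<le> A" by (auto simp: Bseq_def)
    then have "(SUP n. ereal \<bar>\<Phi>n n (x n)\<bar>) \<le> ereal A" by (intro SUP_least) simp
    then show ?thesis using le_less_trans by fastforce
  qed
  moreover have "(\<lambda>n. norm (fderiv (\<Phi>n n) (x n))) \<longlonglongrightarrow> 0"
  proof (rule tendsto_sandwich[OF _ _ tendsto_const])
    show "\<forall>\<^sub>F n in sequentially. norm (fderiv (\<Phi>n n) (x n)) \<le> 8 * inverse (real (Suc (\<kappa> n)))"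
      using x by eventually_elim (simp add: P_def)
    show "(\<lambda>n. 8 * inverse (real (Suc (\<kappa> n)))) \<longlonglongrightarrow> 0"
      using tendsto_mult[OF tendsto_const inv_\<kappa>] by simp
  qed simp
  ultimately obtain k l where k: "strict_mono k" and l: "(x \<circ> k) \<longlonglongrightarrow> l"
    using PS by blast
  have inv_\<kappa>k: "(\<lambda>n. inverse (real (Suc (\<kappa> (k n))))) \<longlonglongrightarrow> 0"
    using LIMSEQ_subseq_LIMSEQ[OF inv_\<kappa> k] by (simp add: o_def)
  have dist_lim: "(\<lambda>n. dist (y (\<kappa> (k n))) (x (k n))) \<longlonglongrightarrow> 0"
  proof (rule tendsto_sandwich[OF _ _ tendsto_const inv_\<kappa>k])
    show "\<forall>\<^sub>F n in sequentially. dist (y (\<kappa> (k n))) (x (k n)) \<le> inverse (real (Suc (\<kappa> (k n))))"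
      using eventually_subseq[OF k x] by eventually_elim (simp add: P_def)
  qed simp
  have y_lim: "(\<lambda>n. y (\<kappa> (k n))) \<longlonglongrightarrow> l"
  proof (rule Lim_transform)
    show "(\<lambda>n. x (k n)) \<longlonglongrightarrow> l" using l by (simp add: o_def)
    show "(\<lambda>n. y (\<kappa> (k n)) - x (k n)) \<longlonglongrightarrow> 0"
      using dist_lim unfolding dist_norm by (rule tendsto_norm_zero_cancel)
  qed
  have "(\<lambda>n. \<Phi> (y (\<kappa> (k n)))) \<longlonglongrightarrow> \<Phi> l"
    using continuous_on_tendsto_compose[OF C1_functional_imp_continuous[OF C1(1), of UNIV] y_lim] by simp
  then have "m \<le> \<Phi> l" using y(1) by (intro LIMSEQ_le_const) auto
  moreover have "fderiv \<Phi> l = 0"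
  proof -
    have "(\<lambda>n. fderiv \<Phi> (y (\<kappa> (k n)))) \<longlonglongrightarrow> fderiv \<Phi> l"
      using C1(1) continuous_on_tendsto_compose[OF _ y_lim, of UNIV "fderiv \<Phi>"]
      by (simp add: C1_functional_def)
    moreover have "(\<lambda>n. fderiv \<Phi> (y (\<kappa> (k n)))) \<longlonglongrightarrow> 0"
      by (rule Lim_null_comparison[OF always_eventually inv_\<kappa>k]) (use y(3) in blast)
    ultimately show ?thesis by (rule LIMSEQ_unique)
  qed
  ultimately show ?thesis
    using m m_pos unfolding I_def by (intro exI[of _ l]) auto
qed

end
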